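(* Let $R$ be a unital $*$-ring and let $a\in R$ be regular. Then the following conditions are equivalent: (i) $a$ is core invertible. (ii) $a+1-aa^{-}$ and $a^*+1-aa^{-}$ are invertible for some $a^{-}\in a\{1\}$. (iii) $a+1-aa^{-}$ is invertible and $a^*+1-aa^{-}$ is left invertible for some $a^{-}\in a\{1\}$. (iv) $a^*a+1-aa^{-}$ and $(a^* )^2+1-aa^{-}$ are invertible for some $a^{-}\in a\{1\}$. (v) $a^*a+1-aa^{-}$ and $(a^* )^2+1-aa^{-}$ are left invertible for some $a^{-}\in a\{1\}$. (vi) $a+1-aa^{-}$ and $(a^* )^2+1-aa^{-}$ are left invertible for some $a^{-}\in a\{1\}$. In this case, for $a^{-}\in a\{1\}$ such that the inverses appearing below exist, $$a^{(\#)}=(a^*a+1-aa^{-})^{-1}a^*=a\left[((a^* )^2+1-aa^{-})^{-1}\right]^*=(a+1-aa^{-})^{-1}a\left((a^*+1-aa^{-})^{-1}\right)^*.$$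
   Context: A unital $*$-ring is an associative (not necessarily commutative) ring $R$ with unity $1$ and an involution $a\mapsto a^*$ satisfying $(a^* )^*=a$, $(a+b)^*=a^*+b^*$, $(ab)^*=b^*a^*$ for all $a,b\in R$. An element $a\in R$ is regular if there is $x\in R$ with $axa=a$; such an $x$ is called an inner inverse of $a$ and denoted $a^{-}$, and $a\{1\}$ is the set of all inner inverses of $a$. In each of (ii)-(vi) the same $a^{-}$ is used in both elements. An element $a\in R$ is core invertible if there exists $x\in R$ such that $axa=a$, $xR=aR$ and $Rx=Ra^*$; such $x$ is unique if it exists, is called the core inverse of $a$, and is denoted by $a^{(\#)}$. *)

theory Defs
  imports Main
begin

text \<open>
  The superclass is \<^class>\<open>ring\<close> together with \<^class>\<open>monoid_mult\<close> rather than
  \<^class>\<open>ring_1\<close>, because \<^class>\<open>ring_1\<close> also requires \<open>0 \<noteq> 1\<close> and so excludes the zero ring.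
\<close>

class unital_star_ring = ring + monoid_mult +
  fixes star :: "'a \<Rightarrow> 'a"  ("(_\<^sup>\<star>)" [1000] 999)
  assumes star_star [simp]: "(a\<^sup>\<star>)\<^sup>\<star> = a"
    and star_add: "(a + b)\<^sup>\<star> = a\<^sup>\<star> + b\<^sup>\<star>"
    and star_mult: "(a * b)\<^sup>\<star> = b\<^sup>\<star> * a\<^sup>\<star>"

definition left_invertible :: "'a::monoid_mult \<Rightarrow> bool" where
  "left_invertible u \<longleftrightarrow> (\<exists>v. v * u = 1)"

definition is_two_sided_inverse :: "'a::monoid_mult \<Rightarrow> 'a \<Rightarrow> bool" where
  "is_two_sided_inverse u v \<longleftrightarrow> u * v = 1 \<and> v * u = 1"

definition invertible :: "'a::monoid_mult \<Rightarrow> bool" where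
  "invertible u \<longleftrightarrow> (\<exists>v. is_two_sided_inverse u v)"

text \<open>Junk value if \<open>u\<close> is not invertible.\<close>

definition ring_inv :: "'a::monoid_mult \<Rightarrow> 'a" where
  "ring_inv u = (THE v. is_two_sided_inverse u v)"

definition inner_inverses :: "'a::semigroup_mult \<Rightarrow> 'a set" where
  "inner_inverses a = {x. a * x * a = a}"

definition regular :: "'a::semigroup_mult \<Rightarrow> bool" where
  "regular a \<longleftrightarrow> (\<exists>x. a * x * a = a)"

definition right_ideal_of :: "'a::semigroup_mult \<Rightarrow> 'a set" where
  "right_ideal_of a = {a * r | r. True}"

definition left_ideal_of :: "'a::semigroup_mult \<Rightarrow> 'a set" where
  "left_ideal_of a = {r * a | r. True}"

definition is_core_inverse :: "'a::unital_star_ring \<Rightarrow> 'a \<Rightarrow> bool" where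
  "is_core_inverse a x \<longleftrightarrow>
     a * x * a = a \<and> right_ideal_of x = right_ideal_of a \<and> left_ideal_of x = left_ideal_of (a\<^sup>\<star>)"

definition core_invertible :: "'a::unital_star_ring \<Rightarrow> bool" where
  "core_invertible a \<longleftrightarrow> (\<exists>x. is_core_inverse a x)"

text \<open>Junk value if \<open>a\<close> is not core invertible; otherwise see \<open>core_inverse_unique\<close> below.\<close>

definition core_inverse :: "'a::unital_star_ring \<Rightarrow> 'a" where
  "core_inverse a = (THE x. is_core_inverse a x)"

lemma two_sided_inverse_unique:
  assumes "is_two_sided_inverse u v" and "is_two_sided_inverse u w"
  shows "v = w"
proof -
  have "v = v * (u * w)" using assms by (simp add: is_two_sided_inverse_def)
  also have "\<dots> = (v * u) * w" by (simp only: mult.assoc)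
  also have "\<dots> = w" using assms by (simp add: is_two_sided_inverse_def)
  finally show ?thesis .
qed

lemma core_inverse_props:
  fixes a x :: "'a::unital_star_ring"
  assumes "is_core_inverse a x"
  shows "a * x * a = a" and "(a * x)\<^sup>\<star> = a * x" and "x * a * x = x"
    and "x * a * a = a" and "a * x * x = x"
proof -
  show axa: "a * x * a = a" using assms by (simp add: is_core_inverse_def)
  have R: "right_ideal_of x = right_ideal_of a"
    and L: "left_ideal_of x = left_ideal_of (a\<^sup>\<star>)"
    using assms by (simp_all add: is_core_inverse_def)
  have "x \<in> right_ideal_of x" and "a \<in> right_ideal_of a" and "x \<in> left_ideal_of x"
    unfolding right_ideal_of_def left_ideal_of_def
    using mult_1_right[of x] mult_1_right[of a] mult_1_left[of x]
    by (metis (mono_tags, lifting) mem_Collect_eq)+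
  then obtain s r t where s: "x = a * s" and r: "a = x * r" and t: "x = t * a\<^sup>\<star>"
    using R L unfolding right_ideal_of_def left_ideal_of_def by blast
  have "a\<^sup>\<star> * (a * x)\<^sup>\<star> = a\<^sup>\<star>" using axa by (metis star_mult)
  then have x1: "x * (a * x)\<^sup>\<star> = x" using t by (metis mult.assoc)
  then have "(a * x) * (a * x)\<^sup>\<star> = a * x" by (simp add: mult.assoc)
  then show sa: "(a * x)\<^sup>\<star> = a * x" by (metis star_mult star_star)
  then show xax: "x * a * x = x" using x1 by (simp add: mult.assoc)
  then show "x * a * a = a" using r by (metis mult.assoc)
  show "a * x * x = x" using axa s by (metis mult.assoc)
qed

lemma core_inverse_unique:
  fixes a x y :: "'a::unital_star_ring"
  assumes "is_core_inverse a x" and "is_core_inverse a y"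
  shows "x = y"
proof -
  note px = core_inverse_props[OF assms(1)] and py = core_inverse_props[OF assms(2)]
  have "a * y * (a * x) = a * x" using py(1) by (metis mult.assoc)
  then have "a * x * (a * y) = a * x" using px(2) py(2) by (metis star_mult)
  moreover have "a * x * (a * y) = a * y" using px(1) by (metis mult.assoc)
  ultimately have eq: "a * x = a * y" by simp
  have "x = x * (a * y)" using px(3) eq by (simp add: mult.assoc)
  also have "\<dots> = x * (a * (a * y * y))" using py(5) by simp
  also have "\<dots> = (x * a * a) * y * y" by (simp add: mult.assoc)
  also have "\<dots> = y" using px(4) py(5) by simp
  finally show ?thesis .
qed

end

theory Submission
  imports Defs
begin

text \<open>
  Multiplying \<open>v * (c + 1 - a * b) = 1\<close> by \<open>a\<close> on the right kills the idempotent \<open>1 - a * b\<close> and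
  leaves \<open>v * c * a = a\<close>. So one-sided invertibility of the elements in the theorem says that \<open>a\<close>
  is a left multiple of some product in \<open>a\<close> and \<open>a\<^sup>\<star>\<close>, and the dependence on \<open>b\<close> disappears.

  The core of the proof (\<open>core_inverse_of_factorizations\<close>) is that two such factorizations,
  \<open>a = q * a\<^sup>\<star> * a\<^sup>\<star> * a\<close> and \<open>a = p * a * a\<close>, already make \<open>a * q\<^sup>\<star>\<close> the core inverse of \<open>a\<close>:
  the first gives an \<open>x\<close> in \<open>a R\<close> for which \<open>a * x\<close> is the projection onto the range of \<open>a\<close>, the
  second makes \<open>x\<close> invert \<open>a\<close> on that range. The conditions that involve \<open>(a\<^sup>\<star>)^2\<close> supply both
  factorizations at once. When only \<open>a\<^sup>\<star> + 1 - a * b\<close> is left invertible, the first one is composed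
  from \<open>a = r * a\<^sup>\<star> * a\<close> and \<open>a = a * a * t\<close>, where the latter uses that \<open>a + 1 - a * b\<close> is also
  right invertible.

  Conversely, if \<open>x\<close> is the core inverse, the inner inverse \<open>b = x\<close> makes \<open>a * x\<close> a projection with
  \<open>(1 - a * x) * a = 0\<close>. Relative to it \<open>a + 1 - a * x\<close> and \<open>a * a + 1 - a * x\<close> are block triangular
  with invertible diagonal, hence invertible; the remaining elements are adjoints and products of
  these. The formulas for the core inverse follow from the same factorizations of \<open>a\<close> and therefore
  hold for arbitrary left inverses and arbitrary inner inverses \<open>b\<close>.
\<close>

section \<open>Involution and invertibility\<close>

lemma star_one [simp]: "(1::'a::unital_star_ring)\<^sup>\<star> = 1"
  by (metis mult_1_left mult_1_right star_mult star_star)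

lemma star_diff: "((a::'a::unital_star_ring) - b)\<^sup>\<star> = a\<^sup>\<star> - b\<^sup>\<star>"
  by (metis add_diff_cancel diff_add_cancel star_add)

lemma invertible_imp_left_invertible: "invertible u \<Longrightarrow> left_invertible u"
  by (auto simp: invertible_def left_invertible_def is_two_sided_inverse_def)

lemma invertible_mult:
  assumes "invertible u" and "invertible v"
  shows "invertible (u * v)"
proof -
  obtain u' v' where "u * u' = 1" "u' * u = 1" "v * v' = 1" "v' * v = 1"
    using assms by (auto simp: invertible_def is_two_sided_inverse_def)
  then have "is_two_sided_inverse (u * v) (v' * u')"
    unfolding is_two_sided_inverse_def by (metis mult.assoc mult_1_left)
  then show ?thesis by (auto simp: invertible_def)
qed

lemma invertible_star:
  fixes u :: "'a::unital_star_ring"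
  assumes "invertible u"
  shows "invertible (u\<^sup>\<star>)"
  using assms unfolding invertible_def is_two_sided_inverse_def by (metis star_mult star_one)

lemma ring_inv_left:
  assumes "invertible u"
  shows "ring_inv u * u = 1"
proof -
  obtain v where v: "is_two_sided_inverse u v" using assms by (auto simp: invertible_def)
  then have "ring_inv u = v"
    unfolding ring_inv_def using two_sided_inverse_unique by blast
  then show ?thesis using v by (simp add: is_two_sided_inverse_def)
qed

text \<open>Since \<open>(1 - a * b) * a = 0\<close>, only the summand \<open>c\<close> survives multiplication by \<open>a\<close>.\<close>

lemma left_inverse_absorbs:
  fixes a b c v :: "'a::{ring,monoid_mult}"
  assumes "v * (c + 1 - a * b) = 1" and "a * b * a = a"
  shows "v * c * a = a"
proof -
  have "a = v * ((c + 1 - a * b) * a)" using assms(1) by (metis mult.assoc mult_1_left)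
  also have "(c + 1 - a * b) * a = c * a" using assms(2) by (simp add: algebra_simps)
  finally show ?thesis by (simp add: mult.assoc)
qed

section \<open>Recognizing core inverses\<close>

lemma is_core_inverseI:
  fixes a x :: "'a::unital_star_ring"
  assumes axa: "a * x * a = a" and sym: "(a * x)\<^sup>\<star> = a * x"
    and xaa: "x * a * a = a" and axx: "a * x * x = x"
  shows "is_core_inverse a x"
proof -
  have "x * a * x = x" using xaa axx by (metis mult.assoc)
  then have x: "x = x * x\<^sup>\<star> * a\<^sup>\<star>" using sym by (metis mult.assoc star_mult)
  have a: "a\<^sup>\<star> = a\<^sup>\<star> * a * x" using axa sym by (metis mult.assoc star_mult)
  have "right_ideal_of x = right_ideal_of a"
    unfolding right_ideal_of_def using xaa axx by (auto, metis mult.assoc, metis mult.assoc)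
  moreover have "left_ideal_of x = left_ideal_of (a\<^sup>\<star>)"
    unfolding left_ideal_of_def using x a by (auto, metis mult.assoc, metis mult.assoc)
  ultimately show ?thesis using axa by (simp add: is_core_inverse_def)
qed

text \<open>
  With \<open>x = a * q\<^sup>\<star>\<close>, the adjoint of the first hypothesis reads \<open>a\<^sup>\<star> = a\<^sup>\<star> * a * x\<close>, which is the
  normal equation saying that \<open>a * x\<close> is a self-adjoint idempotent fixing \<open>a\<close>. Since \<open>x\<close> is a right
  multiple of \<open>a\<close>, the hypothesis on \<open>p\<close> shows that \<open>p * a\<close> fixes \<open>x\<close>, which identifies \<open>x\<close> with
  \<open>p * a * x\<close> and transfers \<open>p * a * a = a\<close> to \<open>x * a * a = a\<close>.
\<close>

lemma core_inverse_of_factorizations: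
  fixes a p q :: "'a::unital_star_ring"
  assumes q: "q * (a\<^sup>\<star> * a\<^sup>\<star>) * a = a" and p: "p * a * a = a"
  shows "is_core_inverse a (a * q\<^sup>\<star>)"
proof -
  define x where "x = a * q\<^sup>\<star>"
  have x_adj: "x\<^sup>\<star> * a\<^sup>\<star> * a = a"
    using q unfolding x_def by (simp add: star_mult mult.assoc)
  then have normal: "a\<^sup>\<star> * a * x = a\<^sup>\<star>" by (metis mult.assoc star_mult star_star)
  have "a * x = x\<^sup>\<star> * a\<^sup>\<star> * a * x" using x_adj by simp
  also have "\<dots> = (a * x)\<^sup>\<star>" using normal by (simp add: mult.assoc star_mult)
  finally have sym: "(a * x)\<^sup>\<star> = a * x" by simp
  then have axa: "a * x * a = a" using x_adj by (simp add: star_mult)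
  then have axx: "a * x * x = x" unfolding x_def by (metis mult.assoc)
  have "p * a * x = x" using p unfolding x_def by (metis mult.assoc)
  then have "x * a * a = p * (a * x * a) * a" by (metis mult.assoc)
  then have "x * a * a = a" using axa p by simp
  with axa sym axx have "is_core_inverse a x" by (intro is_core_inverseI)
  then show ?thesis by (simp add: x_def)
qed

section \<open>Sufficiency of one-sided conditions\<close>

lemma core_invertible_if_left_invertible_normal_and_star_square:
  fixes a :: "'a::unital_star_ring"
  assumes b: "b \<in> inner_inverses a"
    and l: "left_invertible (a\<^sup>\<star> * a + 1 - a * b)"
    and m: "left_invertible ((a\<^sup>\<star>)^2 + 1 - a * b)"
  shows "core_invertible a"
proof -
  have aba: "a * b * a = a" using b by (simp add: inner_inverses_def)
  obtain p where "p * (a\<^sup>\<star> * a + 1 - a * b) = 1" using l by (auto simp: left_invertible_def)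
  from left_inverse_absorbs[OF this aba] have "(p * a\<^sup>\<star>) * a * a = a" by (simp add: mult.assoc)
  moreover obtain q where "q * (a\<^sup>\<star> * a\<^sup>\<star> + 1 - a * b) = 1"
    using m by (auto simp: left_invertible_def power2_eq_square)
  from left_inverse_absorbs[OF this aba] have "q * (a\<^sup>\<star> * a\<^sup>\<star>) * a = a" .
  ultimately show ?thesis using core_inverse_of_factorizations by (auto simp: core_invertible_def)
qed

lemma core_invertible_if_left_invertible_and_star_square:
  fixes a :: "'a::unital_star_ring"
  assumes b: "b \<in> inner_inverses a"
    and l: "left_invertible (a + 1 - a * b)"
    and m: "left_invertible ((a\<^sup>\<star>)^2 + 1 - a * b)"
  shows "core_invertible a"
proof -
  have aba: "a * b * a = a" using b by (simp add: inner_inverses_def)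
  obtain p where "p * (a + 1 - a * b) = 1" using l by (auto simp: left_invertible_def)
  from left_inverse_absorbs[OF this aba] have "p * a * a = a" .
  moreover obtain q where "q * (a\<^sup>\<star> * a\<^sup>\<star> + 1 - a * b) = 1"
    using m by (auto simp: left_invertible_def power2_eq_square)
  from left_inverse_absorbs[OF this aba] have "q * (a\<^sup>\<star> * a\<^sup>\<star>) * a = a" .
  ultimately show ?thesis using core_inverse_of_factorizations by (auto simp: core_invertible_def)
qed

text \<open>
  Multiplying \<open>(a + 1 - a * b) * p = 1\<close> on the left by the idempotents \<open>a * b\<close> and \<open>1 - a * b\<close>
  splits it into \<open>a * p = a * b\<close> and \<open>(1 - a * b) * p = 1 - a * b\<close>. The first says that \<open>p\<close> is
  itself an inner inverse of \<open>a\<close>, the second that the range of \<open>p * a\<close> lies in the range of \<open>a\<close>, so a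
  second factor \<open>a\<close> can be split off from \<open>a * (p * a) = a\<close>.
\<close>

lemma right_inverse_imp_factor:
  fixes a b p :: "'a::{ring,monoid_mult}"
  assumes p: "(a + 1 - a * b) * p = 1" and aba: "a * b * a = a"
  shows "a = a * a * (b * p * a)"
proof -
  have "a * b = a * b * ((a + 1 - a * b) * p)" using p by simp
  also have "\<dots> = (a * b * (a + 1 - a * b)) * p" by (simp only: mult.assoc)
  also have "a * b * (a + 1 - a * b) = a * b * a + a * b - a * b * a * b"
    by (simp add: algebra_simps)
  also have "\<dots> = a" using aba by simp
  finally have ap: "a * p = a * b" by simp
  have "a * p + p - a * b * p = 1" using p by (simp add: algebra_simps)
  then have "p = 1 - a * b + a * b * p" using ap by (simp add: algebra_simps)
  then have "p * a = (1 - a * b + a * b * p) * a" by simp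
  also have "\<dots> = a * b * p * a" using aba by (simp add: algebra_simps)
  finally have pa: "p * a = a * b * p * a" .
  have "a = a * (p * a)" using ap aba by (simp flip: mult.assoc)
  also have "\<dots> = a * a * (b * p * a)" by (subst pa) (simp only: mult.assoc)
  finally show ?thesis .
qed

text \<open>
  Here \<open>a = r * a\<^sup>\<star> * a\<close> together with the adjoint of \<open>a = a * a * t\<close> gives the factorization
  \<open>a = (r * t\<^sup>\<star>) * a\<^sup>\<star> * a\<^sup>\<star> * a\<close>.
\<close>

lemma core_invertible_if_invertible_and_left_invertible_star:
  fixes a :: "'a::unital_star_ring"
  assumes b: "b \<in> inner_inverses a"
    and u: "invertible (a + 1 - a * b)"
    and m: "left_invertible (a\<^sup>\<star> + 1 - a * b)"
  shows "core_invertible a"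
proof -
  have aba: "a * b * a = a" using b by (simp add: inner_inverses_def)
  obtain p where p: "p * (a + 1 - a * b) = 1" "(a + 1 - a * b) * p = 1"
    using u by (auto simp: invertible_def is_two_sided_inverse_def)
  obtain r where "r * (a\<^sup>\<star> + 1 - a * b) = 1" using m by (auto simp: left_invertible_def)
  from left_inverse_absorbs[OF this aba] have r: "r * a\<^sup>\<star> * a = a" .
  have "a\<^sup>\<star> = (b * p * a)\<^sup>\<star> * (a\<^sup>\<star> * a\<^sup>\<star>)"
    using right_inverse_imp_factor[OF p(2) aba] by (metis star_mult)
  then have "(r * (b * p * a)\<^sup>\<star>) * (a\<^sup>\<star> * a\<^sup>\<star>) * a = a" using r by (metis mult.assoc)
  moreover have "p * a * a = a" using left_inverse_absorbs[OF p(1) aba] .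
  ultimately show ?thesis using core_inverse_of_factorizations by (auto simp: core_invertible_def)
qed

section \<open>Necessity of two-sided conditions\<close>

text \<open>
  In block form relative to the projection \<open>a * x\<close>, \<open>a\<close> has rows \<open>(a\<^sub>1, a\<^sub>2)\<close> and \<open>(0, 0)\<close>, and \<open>x\<close>
  inverts the corner \<open>a\<^sub>1\<close>; the explicit inverses are those of the resulting upper triangular
  matrices.
\<close>

lemma invertible_of_core_inverse:
  fixes a x :: "'a::unital_star_ring"
  assumes "is_core_inverse a x"
  shows "invertible (a + 1 - a * x)" and "invertible (a * a + 1 - a * x)"
proof -
  note c = core_inverse_props[OF assms]
  have r: "a * (x * a) = a" "x * (a * x) = x" "x * (a * a) = a" "a * (x * x) = x"
    "\<And>y. a * (x * (a * y)) = a * y" "\<And>y. x * (a * (x * y)) = x * y"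
    "\<And>y. x * (a * (a * y)) = a * y" "\<And>y. a * (x * (x * y)) = x * y"
    using c by (metis mult.assoc)+
  have "is_two_sided_inverse (a + 1 - a * x) (x + 1 - x * a)"
    by (simp add: is_two_sided_inverse_def algebra_simps r)
  then show "invertible (a + 1 - a * x)" by (auto simp: invertible_def)
  have "is_two_sided_inverse (a * a + 1 - a * x) (x * x + 1 - x * a)"
    by (simp add: is_two_sided_inverse_def algebra_simps r)
  then show "invertible (a * a + 1 - a * x)" by (auto simp: invertible_def)
qed

lemma invertible_star_of_core_inverse:
  fixes a x :: "'a::unital_star_ring"
  assumes "is_core_inverse a x"
  shows "invertible (a\<^sup>\<star> + 1 - a * x)" and "invertible ((a\<^sup>\<star>)^2 + 1 - a * x)"
    and "invertible (a\<^sup>\<star> * a + 1 - a * x)"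
proof -
  note c = core_inverse_props[OF assms] and inv = invertible_of_core_inverse[OF assms]
  have "(a + 1 - a * x)\<^sup>\<star> = a\<^sup>\<star> + 1 - a * x"
    using c(2) by (simp only: star_add star_diff star_one)
  with invertible_star[OF inv(1)] show u: "invertible (a\<^sup>\<star> + 1 - a * x)" by simp
  have "(a * a + 1 - a * x)\<^sup>\<star> = a\<^sup>\<star> * a\<^sup>\<star> + 1 - a * x"
    using c(2) by (simp only: star_add star_diff star_one star_mult[of a a])
  with invertible_star[OF inv(2)] show "invertible ((a\<^sup>\<star>)^2 + 1 - a * x)"
    by (simp add: power2_eq_square)
  have r: "a * (x * a) = a" "a\<^sup>\<star> * (a * x) = a\<^sup>\<star>" "\<And>y. a * (x * (a * y)) = a * y"
    using c(1,2) by (metis mult.assoc star_mult)+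
  \<comment> \<open>The mixed terms vanish: \<open>(1 - a * x) * a = 0\<close>, and \<open>a\<^sup>\<star> * (1 - a * x)\<close> is its adjoint.\<close>
  have "(a\<^sup>\<star> + 1 - a * x) * (a + 1 - a * x) = a\<^sup>\<star> * a + 1 - a * x"
    by (simp add: algebra_simps r)
  with invertible_mult[OF u inv(1)] show "invertible (a\<^sup>\<star> * a + 1 - a * x)" by simp
qed

section \<open>Formulas for the core inverse\<close>

text \<open>
  If \<open>p * a * a = a\<close> then \<open>p * a\<close> fixes the right ideal \<open>a R\<close>, which contains \<open>x\<close>.
\<close>

lemma core_inverse_fixed_left:
  fixes a x p :: "'a::unital_star_ring"
  assumes "is_core_inverse a x" and "p * a * a = a"
  shows "p * a * x = x"
  using core_inverse_props(5)[OF assms(1)] assms(2) by (metis mult.assoc)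

text \<open>
  Any solution \<open>s\<close> of the normal equation yields the same projection onto the range of \<open>a\<close>.
\<close>

lemma core_inverse_projection_eq:
  fixes a x s :: "'a::unital_star_ring"
  assumes "is_core_inverse a x" and "s\<^sup>\<star> * a\<^sup>\<star> * a = a"
  shows "a * x = a * s"
proof -
  note c = core_inverse_props[OF assms(1)]
  have "a\<^sup>\<star> = a\<^sup>\<star> * (a * s)" using assms(2) by (metis mult.assoc star_mult star_star)
  then have "x\<^sup>\<star> * a\<^sup>\<star> = x\<^sup>\<star> * a\<^sup>\<star> * (a * s)" by (metis mult.assoc)
  then have "a * x = a * x * (a * s)" using c(2) by (simp add: star_mult)
  then show ?thesis using c(1) by (metis mult.assoc)
qed

lemma core_inverse_formulas:
  fixes a b p q r x :: "'a::unital_star_ring"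
  assumes x: "is_core_inverse a x" and aba: "a * b * a = a"
  shows "p * (a\<^sup>\<star> * a + 1 - a * b) = 1 \<Longrightarrow> x = p * a\<^sup>\<star>"
    and "q * ((a\<^sup>\<star>)^2 + 1 - a * b) = 1 \<Longrightarrow> x = a * q\<^sup>\<star>"
    and "\<lbrakk>p * (a + 1 - a * b) = 1; r * (a\<^sup>\<star> + 1 - a * b) = 1\<rbrakk> \<Longrightarrow> x = p * a * r\<^sup>\<star>"
proof -
  note c = core_inverse_props[OF x]
  show "x = p * a\<^sup>\<star>" if p: "p * (a\<^sup>\<star> * a + 1 - a * b) = 1"
  proof -
    have "(p * a\<^sup>\<star>) * a * a = a" using left_inverse_absorbs[OF p aba] by (simp add: mult.assoc)
    then have "x = p * (a\<^sup>\<star> * (a * x))"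
      using core_inverse_fixed_left[OF x, of "p * a\<^sup>\<star>"] by (simp add: mult.assoc)
    also have "a\<^sup>\<star> * (a * x) = a\<^sup>\<star>" using c(1,2) by (metis star_mult)
    finally show ?thesis .
  qed
  show "x = a * q\<^sup>\<star>" if q: "q * ((a\<^sup>\<star>)^2 + 1 - a * b) = 1"
  proof -
    have "q * (a\<^sup>\<star> * a\<^sup>\<star>) * a = a"
      using left_inverse_absorbs[OF q aba] by (simp add: power2_eq_square)
    then have "is_core_inverse a (a * q\<^sup>\<star>)" using core_inverse_of_factorizations c(4) by blast
    with x show ?thesis by (rule core_inverse_unique)
  qed
  show "x = p * a * r\<^sup>\<star>"
    if p: "p * (a + 1 - a * b) = 1" and r: "r * (a\<^sup>\<star> + 1 - a * b) = 1"
  proof -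
    have "a * x = a * r\<^sup>\<star>"
      using core_inverse_projection_eq[OF x] left_inverse_absorbs[OF r aba] by simp
    moreover have "x = p * (a * x)"
      using core_inverse_fixed_left[OF x left_inverse_absorbs[OF p aba]] by (simp add: mult.assoc)
    ultimately show ?thesis by (simp add: mult.assoc)
  qed
qed

section \<open>The characterization\<close>

theorem theorem4p2:
  fixes a :: "'a::unital_star_ring"
  assumes "regular a"
  shows
    "(core_invertible a \<longleftrightarrow>
        (\<exists>b\<in>inner_inverses a. invertible (a + 1 - a * b) \<and> invertible (a\<^sup>\<star> + 1 - a * b)))
   \<and> (core_invertible a \<longleftrightarrow>
        (\<exists>b\<in>inner_inverses a. invertible (a + 1 - a * b) \<and> left_invertible (a\<^sup>\<star> + 1 - a * b)))
   \<and> (core_invertible a \<longleftrightarrow>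
        (\<exists>b\<in>inner_inverses a.
           invertible (a\<^sup>\<star> * a + 1 - a * b) \<and> invertible ((a\<^sup>\<star>)^2 + 1 - a * b)))
   \<and> (core_invertible a \<longleftrightarrow>
        (\<exists>b\<in>inner_inverses a.
           left_invertible (a\<^sup>\<star> * a + 1 - a * b) \<and> left_invertible ((a\<^sup>\<star>)^2 + 1 - a * b)))
   \<and> (core_invertible a \<longleftrightarrow>
        (\<exists>b\<in>inner_inverses a.
           left_invertible (a + 1 - a * b) \<and> left_invertible ((a\<^sup>\<star>)^2 + 1 - a * b)))
   \<and> (core_invertible a \<longrightarrow>
        (\<forall>b\<in>inner_inverses a.
           (invertible (a\<^sup>\<star> * a + 1 - a * b) \<longrightarrow>
              core_inverse a = ring_inv (a\<^sup>\<star> * a + 1 - a * b) * a\<^sup>\<star>)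
         \<and> (invertible ((a\<^sup>\<star>)^2 + 1 - a * b) \<longrightarrow>
              core_inverse a = a * (ring_inv ((a\<^sup>\<star>)^2 + 1 - a * b))\<^sup>\<star>)
         \<and> (invertible (a + 1 - a * b) \<and> invertible (a\<^sup>\<star> + 1 - a * b) \<longrightarrow>
              core_inverse a =
                ring_inv (a + 1 - a * b) * a * (ring_inv (a\<^sup>\<star> + 1 - a * b))\<^sup>\<star>)))"
proof -
  have necessity: "\<exists>b\<in>inner_inverses a.
      invertible (a + 1 - a * b) \<and> invertible (a\<^sup>\<star> + 1 - a * b)
      \<and> invertible (a\<^sup>\<star> * a + 1 - a * b) \<and> invertible ((a\<^sup>\<star>)^2 + 1 - a * b)"
    if "core_invertible a"
  proof -
    obtain x where x: "is_core_inverse a x"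
      using \<open>core_invertible a\<close> by (auto simp: core_invertible_def)
    then have "x \<in> inner_inverses a" by (simp add: inner_inverses_def is_core_inverse_def)
    then show ?thesis
      using invertible_of_core_inverse[OF x] invertible_star_of_core_inverse[OF x] by blast
  qed
  have formulas: "(invertible (a\<^sup>\<star> * a + 1 - a * b) \<longrightarrow>
              core_inverse a = ring_inv (a\<^sup>\<star> * a + 1 - a * b) * a\<^sup>\<star>)
         \<and> (invertible ((a\<^sup>\<star>)^2 + 1 - a * b) \<longrightarrow>
              core_inverse a = a * (ring_inv ((a\<^sup>\<star>)^2 + 1 - a * b))\<^sup>\<star>)
         \<and> (invertible (a + 1 - a * b) \<and> invertible (a\<^sup>\<star> + 1 - a * b) \<longrightarrow>
              core_inverse a =
                ring_inv (a + 1 - a * b) * a * (ring_inv (a\<^sup>\<star> + 1 - a * b))\<^sup>\<star>)"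
    if "core_invertible a" and b: "b \<in> inner_inverses a" for b
  proof -
    obtain x where x: "is_core_inverse a x"
      using \<open>core_invertible a\<close> by (auto simp: core_invertible_def)
    have "core_inverse a = x"
      unfolding core_inverse_def using x core_inverse_unique by blast
    moreover have "a * b * a = a" using b by (simp add: inner_inverses_def)
    ultimately show ?thesis using core_inverse_formulas[OF x] ring_inv_left by blast
  qed
  note suff = core_invertible_if_invertible_and_left_invertible_star
    core_invertible_if_left_invertible_normal_and_star_square
    core_invertible_if_left_invertible_and_star_square
  show ?thesis
  proof (intro conjI)
    show "core_invertible a \<longleftrightarrow>
        (\<exists>b\<in>inner_inverses a. invertible (a + 1 - a * b) \<and> invertible (a\<^sup>\<star> + 1 - a * b))"
      using necessity suff(1) invertible_imp_left_invertible by blast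
    show "core_invertible a \<longleftrightarrow>
        (\<exists>b\<in>inner_inverses a. invertible (a + 1 - a * b) \<and> left_invertible (a\<^sup>\<star> + 1 - a * b))"
      using necessity suff(1) invertible_imp_left_invertible by blast
    show "core_invertible a \<longleftrightarrow>
        (\<exists>b\<in>inner_inverses a.
           invertible (a\<^sup>\<star> * a + 1 - a * b) \<and> invertible ((a\<^sup>\<star>)^2 + 1 - a * b))"
      using necessity suff(2) invertible_imp_left_invertible by blast
    show "core_invertible a \<longleftrightarrow>
        (\<exists>b\<in>inner_inverses a.
           left_invertible (a\<^sup>\<star> * a + 1 - a * b) \<and> left_invertible ((a\<^sup>\<star>)^2 + 1 - a * b))"
      using necessity suff(2) invertible_imp_left_invertible by blast
    show "core_invertible a \<longleftrightarrow>
        (\<exists>b\<in>inner_inverses a.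
           left_invertible (a + 1 - a * b) \<and> left_invertible ((a\<^sup>\<star>)^2 + 1 - a * b))"
      using necessity suff(3) invertible_imp_left_invertible by blast
  qed (use formulas in blast)
qed

end
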